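(* Let $f\in C(I,I)$ with $h(f)=0$. Then the proximal relation $\mathrm{Prox}_f=\{\langle x,y\rangle\in I^2:\langle x,y\rangle\text{ is proximal}\}$ is an equivalence relation on $I$.
   Context: $I=[0,1]$, $C(I,I)$ continuous self-maps of $I$, $h(f)$ topological entropy. A pair $\langle x,y\rangle\in I^2$ is proximal if $\liminf_{n\to\infty}|f^n(x)-f^n(y)|=0$. *)

theory Defs
  imports "HOL-Analysis.Analysis" "HOL-Library.Liminf_Limsup"
begin

definition sep_set :: "(real \<Rightarrow> real) \<Rightarrow> nat \<Rightarrow> real \<Rightarrow> real set \<Rightarrow> bool" where
  "sep_set f n eps S \<longleftrightarrow> S \<subseteq> {0..1} \<and>
     (\<forall>x\<in>S. \<forall>y\<in>S. x \<noteq> y \<longrightarrow> (\<exists>k<n. \<bar>(f ^^ k) x - (f ^^ k) y\<bar> > eps))"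

text \<open>Maximal cardinality of an (n,eps)-separated set (finite for continuous f on I).\<close>
definition sep_num :: "(real \<Rightarrow> real) \<Rightarrow> nat \<Rightarrow> real \<Rightarrow> nat" where
  "sep_num f n eps = Sup {card S | S. finite S \<and> sep_set f n eps S}"

definition top_entropy :: "(real \<Rightarrow> real) \<Rightarrow> ereal" where
  "top_entropy f = (SUP eps\<in>{0<..}.
      limsup (\<lambda>n. ereal (ln (real (sep_num f n eps)) / real n)))"

definition proximal :: "(real \<Rightarrow> real) \<Rightarrow> real \<Rightarrow> real \<Rightarrow> bool" where
  "proximal f x y \<longleftrightarrow> liminf (\<lambda>n. ereal \<bar>(f ^^ n) x - (f ^^ n) y\<bar>) = 0"

definition Prox :: "(real \<Rightarrow> real) \<Rightarrow> (real \<times> real) set" where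
  "Prox f = {(x, y). x \<in> {0..1} \<and> y \<in> {0..1} \<and> proximal f x y}"

end

theory Submission
  imports Defs
begin

text \<open>
  Zero entropy is used only through the absence of horseshoes for all iterates. Without horseshoes,
  an orbit none of whose subsequences \<open>f\<^bsup>mn\<^esup> x\<close> converges has its ascending points to the left of its
  descending points, hence moves towards a fixed point \<open>z\<close> separating them, and eventually alternates
  between the two sides of \<open>z\<close>. Applying this to \<open>f\<close>, \<open>f\<^sup>2\<close>, \<open>f\<^sup>4\<close>, \<dots>, the residue classes of the orbit
  modulo \<open>2\<^sup>k\<close> eventually have pairwise disjoint convex hulls. Such an orbit cannot be proximal to an
  asymptotically periodic one: three distinct classes would come arbitrarily close together and squeeze
  the middle one to a point. If \<open>x, y\<close> and \<open>y, z\<close> are proximal and not asymptotically periodic, then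
  for large \<open>k\<close> some class is short for both \<open>y\<close> and \<open>z\<close>, because only boundedly many of the
  \<open>2\<^sup>k\<close> disjoint hulls are longer than \<open>\<epsilon>\<close>; as proximality is visible in every class, \<open>x\<close> and \<open>z\<close>
  come close in that class.
\<close>

section \<open>Horseshoes, asymptotic periodicity and reflection\<close>

text \<open>\<open>J\<close> and \<open>K\<close> are plain sets with a uniform gap
  \<open>\<eta>\<close>, which later serves as the scale separating orbits with different
  itineraries. \<open>K\<close> is nonempty as well, since its image covers
  \<open>J\<close>.\<close>

definition horseshoe :: "(real \<Rightarrow> real) \<Rightarrow> bool" where
  "horseshoe G \<longleftrightarrow> (\<exists>J K. \<exists>\<eta>>0. J \<noteq> {} \<and> J \<union> K \<subseteq> G ` J \<and> J \<union> K \<subseteq> G ` K \<and>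
     (\<forall>u\<in>J. \<forall>v\<in>K. \<eta> \<le> \<bar>u - v\<bar>))"

definition horseshoe_free :: "(real \<Rightarrow> real) \<Rightarrow> bool" where
  "horseshoe_free g \<longleftrightarrow> continuous_on UNIV g \<and> (\<forall>m>0. \<not> horseshoe (g ^^ m))"

text \<open>For continuous \<open>g\<close> the limit is fixed by \<open>g ^^ m\<close>, so this
  says that the orbit is attracted to a periodic orbit.\<close>

definition asymptotically_periodic :: "(real \<Rightarrow> real) \<Rightarrow> real \<Rightarrow> bool" where
  "asymptotically_periodic g x \<longleftrightarrow> (\<exists>m>0. convergent (\<lambda>n. (g ^^ (m * n)) x))"

text \<open>Conjugation by negation. It turns the one-sided results below into their mirror
  images.\<close>

definition reflect :: "(real \<Rightarrow> real) \<Rightarrow> real \<Rightarrow> real" where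
  "reflect g = (\<lambda>t. - g (- t))"

lemma continuous_on_funpow:
  fixes g :: "'a::topological_space \<Rightarrow> 'a"
  assumes "continuous_on UNIV g"
  shows "continuous_on UNIV (g ^^ n)"
proof (induction n)
  case 0
  then show ?case by (simp add: id_def)
next
  case (Suc n)
  have "continuous_on UNIV (g \<circ> (g ^^ n))"
    by (rule continuous_on_compose[OF Suc continuous_on_subset[OF assms]]) simp
  then show ?case by simp
qed

lemma funpow_fixed_point: "g z = z \<Longrightarrow> (g ^^ n) z = z"
  by (induction n) auto

lemma horseshoe_free_continuous: "horseshoe_free g \<Longrightarrow> continuous_on S g"
  unfolding horseshoe_free_def by (meson continuous_on_subset subset_UNIV)

lemma horseshoe_free_funpow:
  assumes "horseshoe_free g" "m > 0"
  shows "horseshoe_free (g ^^ m)"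
  using assms unfolding horseshoe_free_def
  by (simp add: continuous_on_funpow funpow_mult)

lemma reflect_reflect [simp]: "reflect (reflect g) = g"
  by (simp add: reflect_def)

lemma funpow_reflect: "reflect g ^^ n = reflect (g ^^ n)"
proof (induction n)
  case 0
  then show ?case by (simp add: reflect_def fun_eq_iff)
next
  case (Suc n)
  then show ?case by (simp add: reflect_def fun_eq_iff)
qed

lemma horseshoe_reflect:
  assumes "horseshoe G"
  shows "horseshoe (reflect G)"
proof -
  obtain J K \<eta> where h: "\<eta> > 0" "J \<noteq> {}" "J \<union> K \<subseteq> G ` J" "J \<union> K \<subseteq> G ` K"
    "\<forall>u\<in>J. \<forall>v\<in>K. \<eta> \<le> \<bar>u - v\<bar>"
    using assms unfolding horseshoe_def by blast
  have img: "reflect G ` (uminus ` S) = uminus ` (G ` S)" for S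
    by (auto simp: reflect_def image_image)
  have "uminus ` J \<union> uminus ` K \<subseteq> reflect G ` (uminus ` J)"
    "uminus ` J \<union> uminus ` K \<subseteq> reflect G ` (uminus ` K)"
    unfolding img using h(3,4) by blast+
  moreover have "\<forall>u\<in>uminus ` J. \<forall>v\<in>uminus ` K. \<eta> \<le> \<bar>u - v\<bar>"
    using h(5) by (auto simp: abs_minus_commute)
  ultimately show ?thesis
    unfolding horseshoe_def
    by (intro exI[of _ "uminus ` J"] exI[of _ "uminus ` K"] exI[of _ \<eta>]) (use h(1,2) in auto)
qed

lemma horseshoe_free_reflect:
  assumes "horseshoe_free g"
  shows "horseshoe_free (reflect g)"
  unfolding horseshoe_free_def
proof (intro conjI allI impI)
  show "continuous_on UNIV (reflect g)"
    unfolding reflect_def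
    by (intro continuous_intros continuous_on_compose2[OF horseshoe_free_continuous[OF assms, of UNIV]]) auto
next
  fix m :: nat
  assume "m > 0"
  then show "\<not> horseshoe (reflect g ^^ m)"
    using assms horseshoe_reflect[of "reflect (g ^^ m)"]
    by (auto simp: horseshoe_free_def funpow_reflect)
qed

lemma asymptotically_periodic_reflect:
  "asymptotically_periodic (reflect g) (- x) \<longleftrightarrow> asymptotically_periodic g x"
  by (simp add: asymptotically_periodic_def funpow_reflect)
     (simp add: reflect_def convergent_minus_iff[symmetric])

section \<open>Horseshoes from the intermediate value theorem\<close>

text \<open>The graph rises from at most \<open>a\<close> to above \<open>s\<close> over
  \<open>[a, y]\<close> and falls back to at most \<open>a\<close> over \<open>[y, s]\<close>.
  Cutting the rising leg at a point \<open>c\<close> where the value \<open>s\<close> is attained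
  leaves two legs that both cover \<open>[a, s]\<close>, with the gap \<open>y - c\<close> between
  them.\<close>

lemma horseshoe_above:
  assumes "continuous_on UNIV G" "a < y" "y < s" "G a \<le> a" "G y > s" "G s \<le> a"
  shows "horseshoe G"
proof -
  have cont: "continuous_on S G" for S
    using assms(1) continuous_on_subset by blast
  obtain c where c: "a \<le> c" "c \<le> y" "G c = s"
    using IVT'[of G a s y] assms cont by fastforce
  have "c < y" using c assms by (cases "c = y") auto
  have "{a..c} \<union> {y..s} \<subseteq> G ` {a..c}"
  proof
    fix t assume "t \<in> {a..c} \<union> {y..s}"
    then show "t \<in> G ` {a..c}"
      using IVT'[of G a t c] c \<open>c < y\<close> assms cont by fastforce
  qed
  moreover have "{a..c} \<union> {y..s} \<subseteq> G ` {y..s}"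
  proof
    fix t assume "t \<in> {a..c} \<union> {y..s}"
    then show "t \<in> G ` {y..s}"
      using IVT2'[of G s t y] c \<open>c < y\<close> assms cont by fastforce
  qed
  moreover have "\<forall>u\<in>{a..c}. \<forall>v\<in>{y..s}. y - c \<le> \<bar>u - v\<bar>" by auto
  moreover have "{a..c} \<noteq> {}" using c by auto
  ultimately show ?thesis
    unfolding horseshoe_def using \<open>c < y\<close> by (metis diff_gt_0_iff_gt)
qed

lemma horseshoe_below:
  assumes "continuous_on UNIV G" "y < a" "s < y" "G a \<ge> a" "G y < s" "G s \<ge> a"
  shows "horseshoe G"
proof -
  have "continuous_on UNIV (reflect G)"
    unfolding reflect_def
    by (intro continuous_intros continuous_on_compose2[OF assms(1)]) auto
  then have "horseshoe (reflect G)"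
    using horseshoe_above[of "reflect G" "- a" "- y" "- s"] assms by (simp add: reflect_def)
  then show ?thesis using horseshoe_reflect by fastforce
qed

lemma fixed_point_between:
  fixes g :: "real \<Rightarrow> real"
  assumes "continuous_on UNIV g" "u \<le> v" "(g u \<le> u \<and> v \<le> g v) \<or> (u \<le> g u \<and> g v \<le> v)"
  shows "\<exists>z. u \<le> z \<and> z \<le> v \<and> g z = z"
proof -
  have cont: "continuous_on {u..v} (\<lambda>t. g t - t)"
    by (intro continuous_intros continuous_on_subset[OF assms(1)]) auto
  have "\<exists>z\<ge>u. z \<le> v \<and> g z - z = 0"
    using IVT'[of "\<lambda>t. g t - t" u 0 v] IVT2'[of "\<lambda>t. g t - t" v 0 u] assms(2,3) cont by auto
  then show ?thesis by auto
qed

section \<open>Order of ascending and descending orbit points\<close>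

text \<open>Let \<open>b\<close> be the least fixed point above \<open>y\<close>. Since
  \<open>g\<close> moves points of \<open>[y, b)\<close> down, the orbit can pass \<open>b\<close>
  only by first dropping below \<open>y\<close> and then jumping over \<open>b\<close>. Such a jump
  forces a fixed point \<open>a\<close> below \<open>y\<close>, and the iterate that performs it
  folds \<open>[a, b]\<close> into a horseshoe.\<close>

lemma no_return_upwards:
  assumes g: "horseshoe_free g" and "g y < y" and u: "(g ^^ m) y > y" "(g ^^ m) y < g ((g ^^ m) y)"
  shows False
proof -
  have cont: "continuous_on UNIV g" using horseshoe_free_continuous[OF g] .
  define u where "u = (g ^^ m) y"
  let ?F = "{y..u} \<inter> {t. g t = t}"
  have "compact ?F"
    by (intro compact_Int_closed closed_Collect_eq cont continuous_intros) auto
  moreover have "?F \<noteq> {}"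
    using fixed_point_between[OF cont, of y u] assms(2) u by (fastforce simp: u_def)
  ultimately obtain b where b: "b \<in> ?F" "\<And>t. t \<in> ?F \<Longrightarrow> b \<le> t"
    using compact_attains_inf[of ?F] by metis
  have "y < b" "b < u" "g b = b"
    using b(1) assms(2) u by (auto simp: u_def less_le)
  have below: "g t < t" if t: "y \<le> t" "t < b" for t
  proof (rule ccontr)
    assume "\<not> g t < t"
    then obtain z where "y \<le> z" "z \<le> t" "g z = z"
      using fixed_point_between[OF cont, of y t] t assms(2) by auto
    then show False using b(2)[of z] t \<open>b < u\<close> by auto
  qed
  \<comment> \<open>The first time beyond \<open>b\<close>; its predecessor \<open>j\<close> is the
    time from which the jump starts.\<close>
  define k where "k = (LEAST k. (g ^^ k) y > b)"
  have "(g ^^ m) y > b" using \<open>b < u\<close> by (simp add: u_def)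
  then have k: "(g ^^ k) y > b"
    unfolding k_def by (rule LeastI)
  have "k \<noteq> 0" using k \<open>y < b\<close> by (cases "k = 0") auto
  then obtain j where j: "k = Suc j" by (cases k) auto
  have "(g ^^ j) y \<le> b"
    using not_less_Least[of j "\<lambda>k. (g ^^ k) y > b"] j by (auto simp: k_def[symmetric])
  moreover have "(g ^^ j) y \<noteq> b"
    using k j \<open>g b = b\<close> by auto
  ultimately have "(g ^^ j) y < b" by simp
  \<comment> \<open>From a point of \<open>[y, b)\<close> the next one would still lie below
    \<open>b\<close>, by \<open>below\<close>.\<close>
  then have "(g ^^ j) y < y"
    using below[of "(g ^^ j) y"] k j by force
  then obtain a where a: "(g ^^ j) y \<le> a" "a \<le> y" "g a = a"
    using fixed_point_between[OF cont, of "(g ^^ j) y" y] assms(2) k j \<open>(g ^^ j) y < b\<close> by auto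
  have "a < y" using a assms(2) by (cases "a = y") auto
  have contk: "continuous_on S (g ^^ i)" for S i
    using continuous_on_funpow[OF cont] continuous_on_subset by blast
  \<comment> \<open>\<open>g ^^ j\<close> sends \<open>y\<close> to at most \<open>a\<close> and
    fixes \<open>b\<close>, so it attains \<open>a\<close> in between. As \<open>a\<close> is fixed,
    \<open>s\<close> is the point that \<open>g ^^ k\<close> folds back to \<open>a\<close>.\<close>
  obtain s where s: "y \<le> s" "s \<le> b" "(g ^^ j) s = a"
    using IVT'[of "g ^^ j" y a b] a \<open>a < y\<close> \<open>y < b\<close> contk funpow_fixed_point[of g b, OF \<open>g b = b\<close>]
    by (metis less_imp_le less_trans)
  have sk: "(g ^^ k) s = a" using s a j by simp
  have "y < s" using sk k \<open>a < y\<close> \<open>y < b\<close> s by (cases "y = s") auto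
  have "horseshoe (g ^^ k)"
    by (rule horseshoe_above[of _ a y s])
       (use contk \<open>a < y\<close> \<open>y < s\<close> sk k s funpow_fixed_point[of g a, OF a(3)] in auto)
  then show False using g \<open>k \<noteq> 0\<close> by (simp add: horseshoe_free_def)
qed

lemma no_return_downwards:
  assumes "horseshoe_free g" "g y > y" "(g ^^ m) y < y" "(g ^^ m) y > g ((g ^^ m) y)"
  shows False
  using no_return_upwards[OF horseshoe_free_reflect[OF assms(1)], of "- y" m] assms
  by (simp add: funpow_reflect) (simp add: reflect_def)

text \<open>In the opposite order, the earlier of the two points would have a later iterate that
  violates \<open>no_return_upwards\<close> or its mirror image, depending on which one comes first
  in time.\<close>

lemma up_less_down:
  assumes g: "horseshoe_free g"
    and "(g ^^ u) x < (g ^^ Suc u) x" "(g ^^ d) x > (g ^^ Suc d) x"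
  shows "(g ^^ u) x < (g ^^ d) x"
proof (rule ccontr)
  assume "\<not> ?thesis"
  moreover have "(g ^^ u) x \<noteq> (g ^^ d) x" using assms(2,3) by auto
  ultimately have less: "(g ^^ d) x < (g ^^ u) x" by simp
  have split: "(g ^^ (b - a)) ((g ^^ a) x) = (g ^^ b) x" if "a \<le> b" for a b
    using that by (metis add_diff_inverse_nat add.commute funpow_add linorder_not_less o_apply)
  show False
  proof (cases "d \<le> u")
    case True
    then show ?thesis
      using no_return_upwards[OF g, of "(g ^^ d) x" "u - d"] split[OF True] assms less by simp
  next
    case False
    then show ?thesis
      using no_return_downwards[OF g, of "(g ^^ u) x" "d - u"] split[of u d] assms less by simp
  qed
qed

section \<open>Criteria for asymptotic periodicity\<close>

lemma asymptotically_periodicI: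
  assumes "convergent (\<lambda>n. (g ^^ n) x)"
  shows "asymptotically_periodic g x"
  unfolding asymptotically_periodic_def using assms by (intro exI[of _ 1]) auto

lemma asymptotically_periodicI_shift:
  assumes "convergent (\<lambda>n. (g ^^ (n + N)) x)"
  shows "asymptotically_periodic g x"
  using assms convergent_ignore_initial_segment[of "\<lambda>n. (g ^^ n) x" N]
  by (intro asymptotically_periodicI) (simp add: add.commute)

lemma asymptotically_periodicI_hits_fixed_point:
  assumes "g ((g ^^ n) x) = (g ^^ n) x"
  shows "asymptotically_periodic g x"
proof (rule asymptotically_periodicI_shift[where N = n])
  have "(g ^^ (k + n)) x = (g ^^ n) x" for k
    using funpow_fixed_point[of g "(g ^^ n) x" k, OF assms] by (simp add: funpow_add)
  then show "convergent (\<lambda>k. (g ^^ (k + n)) x)"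
    by (simp add: convergent_const)
qed

lemma asymptotically_periodicI_increasing:
  assumes b: "bounded (range (\<lambda>n. (g ^^ n) x))" and "\<And>n. n \<ge> N \<Longrightarrow> (g ^^ n) x \<le> (g ^^ Suc n) x"
  shows "asymptotically_periodic g x"
proof (rule asymptotically_periodicI_shift[where N = N], rule Bseq_mono_convergent)
  show "Bseq (\<lambda>n. (g ^^ (n + N)) x)"
    using b by (auto simp: Bseq_eq_bounded intro: bounded_subset)
  show "\<forall>m n. m \<le> n \<longrightarrow> (g ^^ (m + N)) x \<le> (g ^^ (n + N)) x"
    using assms(2) lift_Suc_mono_le[of "\<lambda>n. (g ^^ (n + N)) x"] by auto
qed

lemma bounded_orbit_reflect:
  assumes "bounded (range (\<lambda>n. (g ^^ n) x))"
  shows "bounded (range (\<lambda>n. (reflect g ^^ n) (- x)))"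
proof -
  have "range (\<lambda>n. (reflect g ^^ n) (- x)) = uminus ` range (\<lambda>n. (g ^^ n) x)"
    by (simp add: funpow_reflect image_image) (simp add: reflect_def)
  then show ?thesis using assms by simp
qed

lemma asymptotically_periodicI_decreasing:
  assumes "bounded (range (\<lambda>n. (g ^^ n) x))" and "\<And>n. n \<ge> N \<Longrightarrow> (g ^^ n) x \<ge> (g ^^ Suc n) x"
  shows "asymptotically_periodic g x"
  using asymptotically_periodicI_increasing[OF bounded_orbit_reflect[OF assms(1)], of N] assms(2)
  unfolding asymptotically_periodic_reflect[of g x, symmetric] funpow_reflect
  by (simp add: reflect_def)

section \<open>Alternation around a separating fixed point\<close>

text \<open>Ascending points \<open>U\<close> and descending points \<open>D\<close> both occur, as
  a bounded monotone orbit converges. All of \<open>U\<close> lies below all of \<open>D\<close>,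
  and continuity gives \<open>g\<close> the signs at \<open>Sup U\<close> and \<open>Inf D\<close>
  that force a fixed point between them.\<close>

lemma orbit_monotone_around_fixed_point:
  assumes g: "horseshoe_free g" and bnd: "bounded (range (\<lambda>n. (g ^^ n) x))"
    and nap: "\<not> asymptotically_periodic g x"
  obtains z where "g z = z" "\<And>n. (g ^^ n) x \<noteq> z"
    "\<And>n. (g ^^ n) x < z \<Longrightarrow> (g ^^ n) x < (g ^^ Suc n) x"
    "\<And>n. (g ^^ n) x > z \<Longrightarrow> (g ^^ n) x > (g ^^ Suc n) x"
proof -
  have cont: "continuous_on UNIV g" using horseshoe_free_continuous[OF g] .
  define X where "X n = (g ^^ n) x" for n
  have XS: "X (Suc n) = g (X n)" for n by (simp add: X_def)
  have nofix: "g (X n) \<noteq> X n" for n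
    using asymptotically_periodicI_hits_fixed_point nap by (auto simp: X_def)
  define U where "U = {X n |n. X n < X (Suc n)}"
  define D where "D = {X n |n. X n > X (Suc n)}"
  have "U \<noteq> {}"
  proof
    assume "U = {}"
    then have "X n \<ge> X (Suc n)" for n by (simp add: U_def linorder_not_less)
    then show False
      using asymptotically_periodicI_decreasing[OF bnd, of 0] nap by (simp add: X_def)
  qed
  have "D \<noteq> {}"
  proof
    assume "D = {}"
    then have "X n \<le> X (Suc n)" for n by (simp add: D_def linorder_not_less)
    then show False
      using asymptotically_periodicI_increasing[OF bnd, of 0] nap by (simp add: X_def)
  qed
  have UD: "u < d" if "u \<in> U" "d \<in> D" for u d
    using that up_less_down[OF g] unfolding U_def D_def X_def by blast
  have bdd: "bdd_above U" "bdd_below D"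
    using UD \<open>U \<noteq> {}\<close> \<open>D \<noteq> {}\<close> by (meson bdd_above.I bdd_below.I ex_in_conv less_imp_le)+
  have "Sup U \<le> Inf D"
    using UD \<open>U \<noteq> {}\<close> \<open>D \<noteq> {}\<close> by (meson cInf_greatest cSup_least less_imp_le)
  moreover have "Sup U \<in> {t. t \<le> g t}"
    by (rule closed_subset_contains_Sup[OF closed_Collect_le _ \<open>U \<noteq> {}\<close> bdd(1)])
       (auto intro: cont continuous_intros simp: U_def XS)
  moreover have "Inf D \<in> {t. g t \<le> t}"
    by (rule closed_subset_contains_Inf[OF closed_Collect_le _ \<open>D \<noteq> {}\<close> bdd(2)])
       (auto intro: cont continuous_intros simp: D_def XS)
  ultimately obtain z where z: "Sup U \<le> z" "z \<le> Inf D" "g z = z"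
    using fixed_point_between[OF cont, of "Sup U" "Inf D"] by auto
  have ne: "X n \<noteq> z" for n using nofix[of n] z by auto
  have "X n < X (Suc n)" if "X n < z" for n
  proof (rule ccontr)
    assume "\<not> ?thesis"
    then have "X n \<in> D" using nofix[of n] XS[of n] by (auto simp: D_def)
    then show False using cInf_lower[OF _ bdd(2)] z that by fastforce
  qed
  moreover have "X n > X (Suc n)" if "X n > z" for n
  proof (rule ccontr)
    assume "\<not> ?thesis"
    then have "X n \<in> U" using nofix[of n] XS[of n] by (auto simp: U_def)
    then show False using cSup_upper[OF _ bdd(1)] z that by fastforce
  qed
  ultimately show ?thesis
    using that[of z] z ne by (simp add: X_def)
qed

text \<open>Suppose two consecutive points lie left of \<open>z\<close> infinitely often, at the
  times in \<open>L\<close>. Each such time yields a preimage \<open>w\<close> of \<open>z\<close>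
  which the orbit eventually stays above. With \<open>c\<close> the supremum of the points at times
  in \<open>L\<close>, the case \<open>c < z\<close> makes \<open>c\<close> itself a barrier that
  the orbit violates, and \<open>c = z\<close> makes the orbit converge to \<open>z\<close>.\<close>

lemma not_frequently_left_left:
  assumes g: "horseshoe_free g" and bnd: "bounded (range (\<lambda>n. (g ^^ n) x))"
    and nap: "\<not> asymptotically_periodic g x"
    and z: "g z = z" and ne: "\<And>n. (g ^^ n) x \<noteq> z"
    and up: "\<And>n. (g ^^ n) x < z \<Longrightarrow> (g ^^ n) x < (g ^^ Suc n) x"
    and down: "\<And>n. (g ^^ n) x > z \<Longrightarrow> (g ^^ n) x > (g ^^ Suc n) x"
  shows "\<exists>N. \<forall>n\<ge>N. (g ^^ n) x < z \<longrightarrow> (g ^^ Suc n) x > z"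
proof (rule ccontr)
  define X where "X n = (g ^^ n) x" for n
  have XS: "X (Suc n) = g (X n)" for n by (simp add: X_def)
  note ne = ne[folded X_def] and up = up[folded X_def] and down = down[folded X_def]
  define L where "L = {n. X n < z \<and> X (Suc n) < z}"
  assume "\<not> ?thesis"
  then have freq: "\<exists>n\<ge>N. n \<in> L" for N
    using ne unfolding L_def X_def[symmetric] by (metis (mono_tags, lifting) linorder_neqE_linordered_idom mem_Collect_eq)
  have cont: "continuous_on UNIV g" using horseshoe_free_continuous[OF g] .
  \<comment> \<open>Passing from \<open>(w, z)\<close> to the left of \<open>w\<close> folds \<open>[w, z]\<close> over itself.\<close>
  have barrier: False if "g w = z" "w < X n" "X n < z" "n \<le> m" "X m < w" for w n m
  proof -
    define N where "N = m - n"
    have XN: "(g ^^ N) (X n) = X m"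
      using \<open>n \<le> m\<close> unfolding N_def X_def
      by (metis add_diff_inverse_nat add.commute funpow_add linorder_not_less o_apply)
    have "N \<noteq> 0" using XN that by (cases "N = 0") auto
    then obtain N' where N': "N = Suc N'" by (cases N) auto
    have "(g ^^ N) w = z"
      unfolding N' funpow_Suc_right using that funpow_fixed_point[of g z, OF z] by simp
    then have "horseshoe (g ^^ N)"
      using horseshoe_below[OF continuous_on_funpow[OF cont], of "X n" z w N]
        that XN funpow_fixed_point[of g z, OF z] by simp
    then show False using g \<open>N \<noteq> 0\<close> by (simp add: horseshoe_free_def)
  qed
  have right: "\<exists>m\<ge>n. X m > z" for n
  proof (rule ccontr)
    assume "\<not> ?thesis"
    then have "X m < z" if "m \<ge> n" for m
      using ne[of m] that by force
    then show False
      using asymptotically_periodicI_increasing[OF bnd, of n] up nap less_imp_le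
      by (metis X_def)
  qed
  \<comment> \<open>The orbit climbs from \<open>X n\<close> until it first jumps over
    \<open>z\<close>. The image of \<open>X n\<close> is still left of \<open>z\<close> and that of
    the last point before the jump is right of it, so \<open>w\<close> lies between these two
    points. The last point is above \<open>w\<close>, and \<open>barrier\<close> keeps the orbit
    there.\<close>
  have escape: "\<exists>w. X n < w \<and> w < z \<and> g w = z \<and> (\<exists>P. \<forall>m\<ge>P. X m > w)" if "n \<in> L" for n
  proof -
    define k where "k = (LEAST k. X (n + k) > z)"
    have "\<exists>k. X (n + k) > z" using right[of n] by (metis le_Suc_ex)
    then have k: "X (n + k) > z" unfolding k_def by (rule LeastI_ex)
    have before: "X (n + j) < z" if "j < k" for j
      using not_less_Least[of j "\<lambda>k. X (n + k) > z"] that ne[of "n + j"] by (auto simp: k_def)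
    have "j < k \<Longrightarrow> X n \<le> X (n + j)" for j
    proof (induction j)
      case (Suc j)
      then show ?case using up[OF before[of j]] by simp
    qed simp
    moreover have "k \<noteq> 0" using k \<open>n \<in> L\<close> by (cases "k = 0") (auto simp: L_def)
    ultimately obtain j where j: "k = Suc j" "X n \<le> X (n + j)" "X (n + j) < z"
      using before by (metis lessI not0_implies_Suc)
    have "g (X n) \<le> z" "z \<le> g (X (n + j))"
      using \<open>n \<in> L\<close> k j XS[of n] XS[of "n + j"] by (auto simp: L_def)
    then obtain w where w: "X n \<le> w" "w \<le> X (n + j)" "g w = z"
      using IVT'[of g "X n" z "X (n + j)"] j continuous_on_subset[OF cont] by auto
    have wn: "w \<noteq> X i" for i using w(3) ne[of "Suc i"] XS[of i] by auto
    have "X n < w" "w < X (n + j)" using w wn[of n] wn[of "n + j"] by auto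
    moreover have "X m > w" if "m \<ge> n + j" for m
      using barrier[of w "n + j" m] w wn[of m] j that \<open>w < X (n + j)\<close> by force
    ultimately show ?thesis using w j by (metis less_trans)
  qed
  define c where "c = Sup (X ` L)"
  have bdd: "bdd_above (X ` L)" by (auto simp: L_def intro!: bdd_aboveI[of _ z])
  have "X ` L \<noteq> {}" using freq[of 0] by auto
  then have "c \<le> z" unfolding c_def by (rule cSup_least) (auto simp: L_def)
  have le_c: "X n \<le> c" if "n \<in> L" for n unfolding c_def using bdd that by (auto intro: cSup_upper)
  have near_c: "\<exists>n\<in>L. t < X n" if "t < c" for t
    using less_cSupD[OF \<open>X ` L \<noteq> {}\<close>, of t] that unfolding c_def by auto
  \<comment> \<open>A later time in \<open>L\<close> lies above \<open>w\<close> and at most at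
    \<open>c\<close>, hence \<open>w < c\<close>.\<close>
  have escape_c: "\<exists>w. X n < w \<and> w < c \<and> w < z \<and> g w = z \<and> (\<exists>P. \<forall>m\<ge>P. X m > w)" if "n \<in> L" for n
  proof -
    obtain w P where w: "X n < w" "w < z" "g w = z" "\<forall>m\<ge>P. X m > w" using escape[OF \<open>n \<in> L\<close>] by blast
    obtain m where "m \<ge> P" "m \<in> L" using freq by blast
    then have "w < c" using w le_c[of m] by force
    then show ?thesis using w by blast
  qed
  have isC: "\<exists>d>0. \<forall>s. \<bar>s - t\<bar> < d \<longrightarrow> \<bar>g s - g t\<bar> < e" if "e > 0" for t e
    using cont that unfolding continuous_on_iff dist_real_def by blast
  show False
  proof (cases "c < z")
    case True
    \<comment> \<open>Preimages \<open>w\<close> of \<open>z\<close> accumulate at \<open>c\<close>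
      from the left.\<close>
    have "g c = z"
    proof (rule ccontr)
      assume "g c \<noteq> z"
      then obtain d where d: "d > 0" "\<And>t. \<bar>t - c\<bar> < d \<Longrightarrow> \<bar>g t - g c\<bar> < \<bar>z - g c\<bar>"
        using isC[of "\<bar>z - g c\<bar>" c] by auto
      obtain n where n: "n \<in> L" "c - d < X n" using near_c[of "c - d"] d by auto
      obtain w where w: "X n < w" "w < c" "g w = z" using escape_c[OF n(1)] by blast
      then show False using d(2)[of w] n by auto
    qed
    \<comment> \<open>The tolerance \<open>z - c\<close> puts the image of a point near
      \<open>c\<close> strictly to the right of \<open>c\<close>; for a time in \<open>L\<close>
      that image is also left of \<open>z\<close>, where \<open>barrier\<close> applies with
      \<open>w = c\<close>.\<close>
    then obtain d where d: "d > 0" "\<And>t. \<bar>t - c\<bar> < d \<Longrightarrow> \<bar>g t - z\<bar> < z - c"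
      using isC[of "z - c" c] True by auto
    obtain n where n: "n \<in> L" "c - d < X n" using near_c[of "c - d"] d by auto
    have "X n \<le> c" using le_c n by auto
    then have "c < X (Suc n)" "X (Suc n) < z"
      using d(2)[of "X n"] n XS[of n] by (auto simp: L_def)
    obtain m where m: "m \<ge> Suc n" "m \<in> L" using freq by blast
    have "X m < c" using escape_c[OF m(2)] by auto
    then show False
      using barrier[OF \<open>g c = z\<close> \<open>c < X (Suc n)\<close> \<open>X (Suc n) < z\<close> m(1)] by simp
  next
    case False
    then have "c = z" using \<open>c \<le> z\<close> by simp
    have "X \<longlonglongrightarrow> z"
    proof (rule LIMSEQ_I)
      fix e :: real
      assume "e > 0"
      then obtain d where d: "d > 0" "\<And>t. \<bar>t - z\<bar> < d \<Longrightarrow> \<bar>g t - z\<bar> < e"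
        using isC[of e z] z by auto
      obtain n where n: "n \<in> L" "z - min d e < X n"
        using near_c[of "z - min d e"] d \<open>e > 0\<close> \<open>c = z\<close> by auto
      then obtain P where P: "\<And>m. m \<ge> P \<Longrightarrow> X m > z - min d e"
        using escape[OF n(1)] by (meson less_trans)
      obtain q where q: "q \<ge> P" "q \<in> L" using freq by blast
      \<comment> \<open>From the left side, the previous point is within \<open>d\<close> of
        \<open>z\<close> and its image is below \<open>z + e\<close>; on the right side the orbit
        descends.\<close>
      have "X (q + j) < z + e" for j
      proof (induction j)
        case 0
        then show ?case using q \<open>e > 0\<close> by (auto simp: L_def)
      next
        case (Suc j)
        show ?case
        proof (cases "X (q + j) < z")
          case True
          then show ?thesis
            using d(2)[of "X (q + j)"] P[of "q + j"] q(1) XS[of "q + j"] by (auto simp: min_def split: if_splits)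
        next
          case False
          then show ?thesis
            using down[of "q + j"] ne[of "q + j"] Suc by auto
        qed
      qed
      then have upper: "X m < z + e" if "m \<ge> q" for m
        using that by (metis le_add_diff_inverse)
      have "\<bar>X m - z\<bar> < e" if "m \<ge> q" for m
        using P[of m] upper[OF that] that q(1)
        by (auto simp: abs_less_iff min_def split: if_splits)
      then show "\<exists>no. \<forall>n\<ge>no. norm (X n - z) < e" by auto
    qed
    then show False
      using asymptotically_periodicI[of g x] nap by (auto simp: convergent_def X_def[abs_def])
  qed
qed

text \<open>Two consecutive points on the left are excluded directly, two on the right by passing to
  \<open>reflect g\<close>. As the orbit avoids \<open>z\<close>, only alternation remains.\<close>

lemma eventually_alternating:
  assumes g: "horseshoe_free g" and bnd: "bounded (range (\<lambda>n. (g ^^ n) x))"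
    and nap: "\<not> asymptotically_periodic g x"
  shows "\<exists>z N. (\<forall>n\<ge>N. (g ^^ n) x < z \<longleftrightarrow> (g ^^ Suc n) x > z) \<and> (\<forall>n. (g ^^ n) x \<noteq> z)"
proof -
  obtain z where z: "g z = z" "\<And>n. (g ^^ n) x \<noteq> z"
    "\<And>n. (g ^^ n) x < z \<Longrightarrow> (g ^^ n) x < (g ^^ Suc n) x"
    "\<And>n. (g ^^ n) x > z \<Longrightarrow> (g ^^ n) x > (g ^^ Suc n) x"
    using orbit_monotone_around_fixed_point[OF assms] by blast
  obtain N1 where N1: "\<And>n. n \<ge> N1 \<Longrightarrow> (g ^^ n) x < z \<Longrightarrow> (g ^^ Suc n) x > z"
    using not_frequently_left_left[OF assms z] by blast
  have R: "(reflect g ^^ n) (- x) = - (g ^^ n) x" for n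
    unfolding funpow_reflect by (simp add: reflect_def)
  have "\<exists>N. \<forall>n\<ge>N. (reflect g ^^ n) (- x) < - z \<longrightarrow> (reflect g ^^ Suc n) (- x) > - z"
    by (rule not_frequently_left_left[OF horseshoe_free_reflect[OF g] bounded_orbit_reflect[OF bnd]])
       (use nap z in \<open>simp_all only: asymptotically_periodic_reflect R neg_less_iff_less neg_equal_iff_equal\<close>,
         simp_all add: reflect_def)
  then obtain N2 where N2: "\<And>n. n \<ge> N2 \<Longrightarrow> (g ^^ n) x > z \<Longrightarrow> (g ^^ Suc n) x < z"
    unfolding R by (auto simp only: neg_less_iff_less)
  have "(g ^^ n) x < z \<longleftrightarrow> (g ^^ Suc n) x > z" if "n \<ge> max N1 N2" for n
    using N1[of n] N2[of n] z(2)[of n] that by fastforce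
  then show ?thesis using z(2) by blast
qed

section \<open>Separation of residue classes modulo powers of two\<close>

text \<open>Applying \<open>g ^^ (m * i - i)\<close> to the points at times \<open>m * n + i\<close>
  moves them to the times \<open>m * (n + i)\<close>, which are multiples of \<open>m\<close>, and
  continuity preserves convergence.\<close>

lemma asymptotically_periodic_shift:
  assumes "continuous_on UNIV g" "asymptotically_periodic g ((g ^^ i) x)"
  shows "asymptotically_periodic g x"
proof -
  obtain m l where m: "m > 0" and l: "(\<lambda>n. (g ^^ (m * n)) ((g ^^ i) x)) \<longlonglongrightarrow> l"
    using assms(2) unfolding asymptotically_periodic_def convergent_def by blast
  have "isCont (g ^^ (m * i - i)) l"
    using continuous_on_funpow[OF assms(1)] by (simp add: continuous_on_eq_continuous_at)
  from isCont_tendsto_compose[OF this l]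
  have "convergent (\<lambda>n. (g ^^ (m * i - i)) ((g ^^ (m * n)) ((g ^^ i) x)))"
    by (auto simp: convergent_def)
  moreover have "(g ^^ (m * i - i)) ((g ^^ (m * n)) ((g ^^ i) x)) = (g ^^ (m * (n + i))) x" for n
  proof -
    have "i \<le> m * i" using m by simp
    then have "m * (n + i) = (m * i - i) + (m * n + i)" unfolding add_mult_distrib2 by linarith
    then show ?thesis by (simp only: funpow_add o_apply)
  qed
  ultimately have "convergent (\<lambda>n. (g ^^ (m * (n + i))) x)" by simp
  then have "convergent (\<lambda>n. (g ^^ (m * n)) x)"
    using convergent_ignore_initial_segment[of "\<lambda>n. (g ^^ (m * n)) x" i] by simp
  then show ?thesis using m unfolding asymptotically_periodic_def by blast
qed

lemma asymptotically_periodic_funpow: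
  assumes "asymptotically_periodic (g ^^ M) x" "M > 0"
  shows "asymptotically_periodic g x"
proof -
  obtain m where "m > 0" "convergent (\<lambda>n. (g ^^ ((M * m) * n)) x)"
    using assms(1) unfolding asymptotically_periodic_def funpow_mult by (auto simp: mult.assoc)
  then show ?thesis using assms(2) unfolding asymptotically_periodic_def
    by (intro exI[of _ "M * m"]) simp
qed

text \<open>Betweenness form of: the convex hulls of the residue classes modulo \<open>M\<close> of the tail of the
  sequence are pairwise disjoint.\<close>

definition separated :: "(nat \<Rightarrow> real) \<Rightarrow> nat \<Rightarrow> nat \<Rightarrow> bool" where
  "separated X M N \<longleftrightarrow> (\<forall>p\<ge>N. \<forall>q\<ge>N. \<forall>r\<ge>N. p mod M = r mod M \<longrightarrow> q mod M \<noteq> p mod M \<longrightarrow>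
     \<not> (X p \<le> X q \<and> X q \<le> X r))"

lemma alternating_parity:
  assumes "\<And>n. n \<ge> N \<Longrightarrow> P (Suc n) \<longleftrightarrow> \<not> P n" "a \<ge> N" "b \<ge> N"
  shows "(P a \<longleftrightarrow> P b) \<longleftrightarrow> (even a \<longleftrightarrow> even b)"
proof -
  have "P (N + j) \<longleftrightarrow> (P N \<longleftrightarrow> even j)" for j
    by (induction j) (use assms(1) in auto)
  from this[of "a - N"] this[of "b - N"] show ?thesis
    using assms(2,3) by (auto simp: even_diff_nat)
qed

text \<open>Induction on \<open>k\<close>. A class modulo \<open>M = 2 ^ k\<close> is an orbit of
  \<open>g ^^ M\<close>, which is again horseshoe-free. This orbit eventually alternates around a
  point \<open>z i\<close>, so the class splits into two classes modulo \<open>2 * M\<close> on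
  opposite sides of \<open>z i\<close>.\<close>

lemma residue_classes_separated:
  assumes g: "horseshoe_free g" and bnd: "bounded (range (\<lambda>n. (g ^^ n) x))"
    and nap: "\<not> asymptotically_periodic g x"
  shows "\<exists>N. separated (\<lambda>n. (g ^^ n) x) (2 ^ k) N"
proof (induction k)
  case 0
  then show ?case by (simp add: separated_def)
next
  case (Suc k)
  define X where "X n = (g ^^ n) x" for n
  define M :: nat where "M = 2 ^ k"
  have "M > 0" by (simp add: M_def)
  obtain N where N: "separated X M N" using Suc by (auto simp: X_def[abs_def] M_def)
  have XM: "((g ^^ M) ^^ n) ((g ^^ i) x) = X (M * n + i)" for n i
    by (simp add: X_def funpow_mult funpow_add)
  have "\<exists>z K. (\<forall>n\<ge>K. X (M * n + i) < z \<longleftrightarrow> X (M * Suc n + i) > z) \<and> (\<forall>n. X (M * n + i) \<noteq> z)" for i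
  proof -
    have "\<not> asymptotically_periodic (g ^^ M) ((g ^^ i) x)"
      using asymptotically_periodic_funpow[OF _ \<open>M > 0\<close>] nap
        asymptotically_periodic_shift[OF horseshoe_free_continuous[OF g]] by blast
    moreover have "bounded (range (\<lambda>n. ((g ^^ M) ^^ n) ((g ^^ i) x)))"
      unfolding XM by (rule bounded_subset[OF bnd]) (auto simp: X_def)
    ultimately show ?thesis
      using eventually_alternating[OF horseshoe_free_funpow[OF g \<open>M > 0\<close>], of "(g ^^ i) x"]
      unfolding XM by simp
  qed
  then obtain z K where alt: "\<And>i n. n \<ge> K i \<Longrightarrow> X (M * n + i) < z i \<longleftrightarrow> X (M * Suc n + i) > z i"
    and ne: "\<And>i n. X (M * n + i) \<noteq> z i"
    by metis
  have side: "(X (M * a + i) < z i \<longleftrightarrow> X (M * b + i) < z i) \<longleftrightarrow> (even a \<longleftrightarrow> even b)"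
    if "a \<ge> K i" "b \<ge> K i" for a b i
    by (rule alternating_parity[of "K i"])
       (use alt[of i] ne[of _ i] that linorder_neqE_linordered_idom in \<open>blast dest: less_asym\<close>)+
  \<comment> \<open>A common bound for all \<open>K i\<close>: from time \<open>M * S\<close> on,
    the index \<open>t div M\<close> within each class is past the start of its alternation.\<close>
  define S where "S = (\<Sum>i<M. K i)"
  have "separated X (M * 2) (max N (M * S))"
    unfolding separated_def
  proof (intro allI impI notI)
    fix p q r
    assume ge: "max N (M * S) \<le> p" "max N (M * S) \<le> q" "max N (M * S) \<le> r"
      and pr: "p mod (M * 2) = r mod (M * 2)" and pq: "q mod (M * 2) \<noteq> p mod (M * 2)"
      and le: "X p \<le> X q \<and> X q \<le> X r"
    have pr1: "p mod M = r mod M" using pr by (metis mod_mult_right_eq mod_mod_cancel dvd_triv_left)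
    then have pr2: "even (p div M) \<longleftrightarrow> even (r div M)"
      using pr \<open>M > 0\<close> unfolding mod_mult2_eq[of _ M 2] by (simp add: even_iff_mod_2_eq_zero)
    show False
    proof (cases "q mod M = p mod M")
      case False
      then show False using N le ge pr1 unfolding separated_def by (meson max.boundedE)
    next
      case True
      define i where "i = p mod M"
      have "i < M" using \<open>M > 0\<close> by (simp add: i_def)
      have pq2: "\<not> (even (p div M) \<longleftrightarrow> even (q div M))"
      proof
        assume "even (p div M) \<longleftrightarrow> even (q div M)"
        then have "p div M mod 2 = q div M mod 2" by (simp add: mod2_eq_if)
        then show False using pq True unfolding mod_mult2_eq[of _ M 2] by simp
      qed
      have KS: "K i \<le> t div M" if "max N (M * S) \<le> t" for t
      proof -
        have "K i \<le> S" unfolding S_def using \<open>i < M\<close> by (intro member_le_sum) auto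
        also have "S \<le> t div M" using that \<open>M > 0\<close> by (simp add: less_eq_div_iff_mult_less_eq mult.commute)
        finally show ?thesis .
      qed
      have eqs: "p = M * (p div M) + i" "q = M * (q div M) + i" "r = M * (r div M) + i"
        using pr1 True by (simp_all add: i_def) (metis mult_div_mod_eq)+
      have "X p < z i \<longleftrightarrow> X r < z i" "\<not> (X p < z i \<longleftrightarrow> X q < z i)"
        using side[OF KS KS, OF ge(1,3)] side[OF KS KS, OF ge(1,2)] pr2 pq2 eqs by auto
      then show False using le by auto
    qed
  qed
  moreover have "X = (\<lambda>n. (g ^^ n) x)" "M * 2 = 2 ^ Suc k" by (auto simp: X_def M_def)
  ultimately show ?case by metis
qed

section \<open>Width and position of separated classes\<close>

text \<open>The bound does not depend on \<open>M\<close>, so for large \<open>M\<close> most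
  classes have a tail of diameter at most \<open>e\<close>.\<close>

lemma few_wide_classes:
  assumes sep: "separated X M N" and range: "range X \<subseteq> {0..1}" and "e > 0"
  defines "W \<equiv> {i. i < M \<and> (\<exists>p\<ge>N. \<exists>q\<ge>N. p mod M = i \<and> q mod M = i \<and> X q - X p > e)}"
  shows "card W \<le> nat (\<lfloor>1 / e\<rfloor> + 1)"
proof -
  define R where "R i p q \<longleftrightarrow> N \<le> p \<and> N \<le> q \<and> p mod M = i \<and> q mod M = i \<and> X q - X p > e" for i p q
  have "\<forall>i\<in>W. \<exists>p q. R i p q" by (auto simp: W_def R_def)
  then obtain p q where R: "\<And>i. i \<in> W \<Longrightarrow> R i (p i) (q i)" by metis
  note pq = R[unfolded R_def]
  \<comment> \<open>A class wider than \<open>e\<close> contains a multiple of \<open>e\<close> in its hull, and disjoint hulls contain different ones.\<close>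
  define j where "j i = \<lfloor>X (q i) / e\<rfloor>" for i
  have between: "X (p i) \<le> e * of_int (j i)" "e * of_int (j i) \<le> X (q i)" if "i \<in> W" for i
  proof -
    have "of_int (j i) \<le> X (q i) / e" "X (q i) / e < of_int (j i) + 1"
      unfolding j_def by linarith+
    then have "e * of_int (j i) \<le> X (q i)" "X (q i) < e * of_int (j i) + e"
      using \<open>e > 0\<close> by (simp_all add: field_simps)
    then show "X (p i) \<le> e * of_int (j i)" "e * of_int (j i) \<le> X (q i)"
      using pq[OF that] by auto
  qed
  have "inj_on j W"
  proof (rule inj_onI, rule ccontr)
    fix a b
    assume ab: "a \<in> W" "b \<in> W" "j a = j b" "a \<noteq> b"
    have "X (p a) \<le> X (q b)" "X (p b) \<le> X (q a)"
      using between[OF ab(1)] between[OF ab(2)] ab(3) by auto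
    then have "(X (p a) \<le> X (p b) \<and> X (p b) \<le> X (q a)) \<or> (X (p b) \<le> X (p a) \<and> X (p a) \<le> X (q b))"
      by auto
    then show False
      using sep pq[OF ab(1)] pq[OF ab(2)] ab(4) unfolding separated_def by metis
  qed
  moreover have "j ` W \<subseteq> {0..\<lfloor>1 / e\<rfloor>}"
  proof (intro image_subsetI)
    fix i
    have "X (q i) \<in> {0..1}" by (rule subsetD[OF range rangeI])
    then show "j i \<in> {0..\<lfloor>1 / e\<rfloor>}"
      using \<open>e > 0\<close> by (auto simp: j_def intro!: floor_mono divide_right_mono)
  qed
  ultimately have "card W \<le> card {0..\<lfloor>1 / e\<rfloor>}"
    by (intro card_inj_on_le[of j]) auto
  then show ?thesis by simp
qed

text \<open>Of the three points, take the middle one. Its class cannot reach past either outer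
  point, since that point would then lie in the hull of a foreign class.\<close>

lemma middle_class_confined:
  assumes sep: "separated X M N" and ge: "a1 \<ge> N" "a2 \<ge> N" "a3 \<ge> N"
    and ne: "a1 mod M \<noteq> a2 mod M" "a2 mod M \<noteq> a3 mod M" "a1 mod M \<noteq> a3 mod M"
    and "\<forall>a\<in>{a1, a2, a3}. lo \<le> X a \<and> X a \<le> hi"
  shows "\<exists>b\<in>{a1, a2, a3}. \<forall>p\<ge>N. p mod M = b mod M \<longrightarrow> lo \<le> X p \<and> X p \<le> hi"
proof -
  have mid: "\<forall>p\<ge>N. p mod M = b mod M \<longrightarrow> lo \<le> X p \<and> X p \<le> hi"
    if h: "a \<ge> N" "b \<ge> N" "c \<ge> N" "a mod M \<noteq> b mod M" "b mod M \<noteq> c mod M"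
      "X a \<le> X b" "X b \<le> X c" "lo \<le> X a" "X c \<le> hi" for a b c
  proof (intro allI impI)
    fix p assume p: "p \<ge> N" "p mod M = b mod M"
    have "\<not> (X p \<le> X a \<and> X a \<le> X b)" "\<not> (X b \<le> X c \<and> X c \<le> X p)"
      using sep p h unfolding separated_def by metis+
    then show "lo \<le> X p \<and> X p \<le> hi" using h by linarith
  qed
  consider "X a1 \<le> X a2" "X a2 \<le> X a3" | "X a3 \<le> X a2" "X a2 \<le> X a1"
    | "X a2 \<le> X a1" "X a1 \<le> X a3" | "X a3 \<le> X a1" "X a1 \<le> X a2"
    | "X a1 \<le> X a3" "X a3 \<le> X a2" | "X a2 \<le> X a3" "X a3 \<le> X a1"
    by linarith
  then show ?thesis
  proof cases
    case 1
    then show ?thesis using mid[of a1 a2 a3] ge ne assms(8) by auto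
  next
    case 2
    then show ?thesis using mid[of a3 a2 a1] ge ne assms(8) by auto
  next
    case 3
    then show ?thesis using mid[of a2 a1 a3] ge ne assms(8) by auto
  next
    case 4
    then show ?thesis using mid[of a3 a1 a2] ge ne assms(8) by auto
  next
    case 5
    then show ?thesis using mid[of a1 a3 a2] ge ne assms(8) by auto
  next
    case 6
    then show ?thesis using mid[of a2 a3 a1] ge ne assms(8) by auto
  qed
qed

section \<open>Proximality in epsilon form and along residue classes\<close>

definition frequently_close :: "(real \<Rightarrow> real) \<Rightarrow> real \<Rightarrow> real \<Rightarrow> bool" where
  "frequently_close g x y \<longleftrightarrow> (\<forall>e>0. \<forall>N. \<exists>n\<ge>N. \<bar>(g ^^ n) x - (g ^^ n) y\<bar> < e)"

lemma frequently_close_sym: "frequently_close g x y \<longleftrightarrow> frequently_close g y x"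
  by (simp add: frequently_close_def abs_minus_commute)

lemma funpow_in: "g ` S \<subseteq> S \<Longrightarrow> x \<in> S \<Longrightarrow> (g ^^ n) x \<in> S"
  by (induction n) auto

lemma proximal_iff_frequently_close: "proximal g x y \<longleftrightarrow> frequently_close g x y"
proof -
  define a where "a n = \<bar>(g ^^ n) x - (g ^^ n) y\<bar>" for n
  have nonneg: "0 \<le> liminf (\<lambda>n. ereal (a n))"
    by (rule Liminf_bounded) (simp add: a_def)
  have "liminf (\<lambda>n. ereal (a n)) \<le> 0 \<longleftrightarrow> (\<forall>e>0. \<forall>N. \<exists>n\<ge>N. a n < e)"
  proof
    assume le: "liminf (\<lambda>n. ereal (a n)) \<le> 0"
    show "\<forall>e>0. \<forall>N. \<exists>n\<ge>N. a n < e"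
    proof (intro allI impI, rule ccontr)
      fix e :: real and N
      assume "e > 0" "\<not> (\<exists>n\<ge>N. a n < e)"
      then have "\<forall>\<^sub>F n in sequentially. ereal e \<le> ereal (a n)"
        unfolding eventually_sequentially by (intro exI[of _ N]) (auto simp: not_less)
      then have "ereal e \<le> liminf (\<lambda>n. ereal (a n))" by (rule Liminf_bounded)
      from this le have "ereal e \<le> 0" by (rule order_trans)
      then show False using \<open>e > 0\<close> by simp
    qed
  next
    assume freq: "\<forall>e>0. \<forall>N. \<exists>n\<ge>N. a n < e"
    show "liminf (\<lambda>n. ereal (a n)) \<le> 0"
    proof (rule ccontr)
      assume "\<not> ?thesis"
      then obtain e where e: "0 < ereal e" "ereal e < liminf (\<lambda>n. ereal (a n))"
        using ereal_dense2[of 0 "liminf (\<lambda>n. ereal (a n))"] by (auto simp: not_le)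
      then obtain N where "\<And>n. n \<ge> N \<Longrightarrow> e < a n"
        using less_LiminfD[OF e(2)] unfolding eventually_sequentially by auto
      moreover obtain n where "n \<ge> N" "a n < e" using freq e(1) by auto
      ultimately show False by force
    qed
  qed
  moreover have "liminf (\<lambda>n. ereal (a n)) = 0 \<longleftrightarrow> liminf (\<lambda>n. ereal (a n)) \<le> 0"
    using nonneg by (auto intro: antisym)
  ultimately show ?thesis
    unfolding proximal_def frequently_close_def a_def by (rule trans[rotated])
qed

lemma uniformly_close_iterates:
  fixes g :: "real \<Rightarrow> real"
  assumes cont: "continuous_on {0..1} g" and inv: "g ` {0..1} \<subseteq> {0..1}" and "e > 0"
  shows "\<exists>d>0. \<forall>u\<in>{0..1}. \<forall>v\<in>{0..1}. \<bar>u - v\<bar> < d \<longrightarrow> (\<forall>j\<le>L. \<bar>(g ^^ j) u - (g ^^ j) v\<bar> < e)"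
proof (induction L)
  case 0
  then show ?case using \<open>e > 0\<close> by auto
next
  case (Suc L)
  then obtain d where d: "d > 0"
    "\<And>u v. u \<in> {0..1} \<Longrightarrow> v \<in> {0..1} \<Longrightarrow> \<bar>u - v\<bar> < d \<Longrightarrow> \<forall>j\<le>L. \<bar>(g ^^ j) u - (g ^^ j) v\<bar> < e"
    by blast
  have "uniformly_continuous_on {0..1} g"
    by (rule compact_uniformly_continuous[OF cont]) simp
  then obtain d' where d': "d' > 0"
    "\<And>u v. u \<in> {0..1} \<Longrightarrow> v \<in> {0..1} \<Longrightarrow> \<bar>u - v\<bar> < d' \<Longrightarrow> \<bar>g u - g v\<bar> < d"
    using \<open>d > 0\<close> unfolding uniformly_continuous_on_def dist_real_def by metis
  show ?case
  proof (intro exI[of _ "min d' e"] conjI ballI impI allI)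
    show "min d' e > 0" using d' \<open>e > 0\<close> by simp
    fix u v :: real and j
    assume uv: "u \<in> {0..1}" "v \<in> {0..1}" "\<bar>u - v\<bar> < min d' e" and "j \<le> Suc L"
    show "\<bar>(g ^^ j) u - (g ^^ j) v\<bar> < e"
    proof (cases j)
      case 0
      then show ?thesis using uv by simp
    next
      case (Suc i)
      have "\<bar>g u - g v\<bar> < d" using d'(2) uv by simp
      then have "\<bar>(g ^^ i) (g u) - (g ^^ i) (g v)\<bar> < e"
        using d(2)[of "g u" "g v"] uv(1,2) inv Suc \<open>j \<le> Suc L\<close> by (meson Suc_le_mono image_subset_iff)
      then show ?thesis unfolding Suc funpow_Suc_right by simp
    qed
  qed
qed

text \<open>By uniform continuity, closeness at one time persists for any prescribed number of
  steps. This leaves room to wait for the residue \<open>i\<close> and then to stay close for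
  \<open>L\<close> further steps.\<close>

lemma frequently_close_window:
  fixes g :: "real \<Rightarrow> real"
  assumes cont: "continuous_on {0..1} g" and inv: "g ` {0..1} \<subseteq> {0..1}"
    and x: "x \<in> {0..1}" and y: "y \<in> {0..1}" and close: "frequently_close g x y"
    and "e > 0" "i < M"
  obtains n where "n \<ge> N" "n mod M = i" "\<And>j. j \<le> L \<Longrightarrow> \<bar>(g ^^ (n + j)) x - (g ^^ (n + j)) y\<bar> < e"
proof -
  obtain d where d: "d > 0" "\<And>u v. u \<in> {0..1} \<Longrightarrow> v \<in> {0..1} \<Longrightarrow> \<bar>u - v\<bar> < d \<Longrightarrow>
    \<forall>j\<le>L + 2 * M. \<bar>(g ^^ j) u - (g ^^ j) v\<bar> < e"
    using uniformly_close_iterates[OF cont inv \<open>e > 0\<close>, of "L + 2 * M"] by blast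
  obtain n where n: "n \<ge> N" "\<bar>(g ^^ n) x - (g ^^ n) y\<bar> < d"
    using close d unfolding frequently_close_def by blast
  \<comment> \<open>The waiting time to residue \<open>i\<close>. It is below \<open>2 * M\<close>,
    which explains the horizon \<open>L + 2 * M\<close>.\<close>
  define s where "s = i + (M - n mod M)"
  have "n mod M < M" using \<open>i < M\<close> by simp
  have "(n + s) mod M = (n mod M + s) mod M" by (simp add: mod_add_left_eq)
  also have "n mod M + s = i + M" using \<open>n mod M < M\<close> by (simp add: s_def)
  finally have "(n + s) mod M = i" using \<open>i < M\<close> by simp
  moreover have "\<bar>(g ^^ (n + s + j)) x - (g ^^ (n + s + j)) y\<bar> < e" if "j \<le> L" for j
  proof -
    have "s + j \<le> L + 2 * M" using that \<open>i < M\<close> by (simp add: s_def)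
    then have "\<bar>(g ^^ (s + j)) ((g ^^ n) x) - (g ^^ (s + j)) ((g ^^ n) y)\<bar> < e"
      using d(2)[OF funpow_in[OF inv x] funpow_in[OF inv y] n(2)] by blast
    moreover have "n + s + j = (s + j) + n" by simp
    ultimately show ?thesis by (simp only: funpow_add o_apply)
  qed
  ultimately show ?thesis using that[of "n + s"] n(1) by simp
qed

section \<open>Transitivity of proximality\<close>

text \<open>Otherwise the orbit of \<open>x\<close> has separated classes, each with at least two
  values in its tail. At three times spaced by \<open>m\<close> it comes near the limit
  \<open>l\<close> of \<open>y\<close>, so one whole class is confined near \<open>l\<close>, more
  tightly than its two values allow.\<close>

lemma frequently_close_asymptotically_periodic:
  fixes g :: "real \<Rightarrow> real"
  assumes g: "horseshoe_free g" and inv: "g ` {0..1} \<subseteq> {0..1}"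
    and x: "x \<in> {0..1}" and y: "y \<in> {0..1}" and close: "frequently_close g x y"
    and ap: "asymptotically_periodic g y"
  shows "asymptotically_periodic g x"
proof (rule ccontr)
  assume nap: "\<not> ?thesis"
  define X where "X = (\<lambda>n. (g ^^ n) x)"
  obtain m l where m: "m > 0" and l: "(\<lambda>n. (g ^^ (m * n)) y) \<longlonglongrightarrow> l"
    using ap unfolding asymptotically_periodic_def convergent_def by blast
  \<comment> \<open>A power of two above \<open>2 * m\<close>, so that \<open>n\<close>,
    \<open>n + m\<close> and \<open>n + 2 * m\<close> lie in different classes.\<close>
  define M :: nat where "M = 2 ^ (2 * m)"
  have "2 * m < M" unfolding M_def by (rule less_exp)
  have X01: "X n \<in> {0..1}" for n unfolding X_def by (rule funpow_in[OF inv x])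
  then have bnd: "bounded (range (\<lambda>n. (g ^^ n) x))"
    by (intro bounded_subset[OF bounded_closed_interval[of 0 1]]) (auto simp: X_def)
  obtain N where N: "separated X M N"
    using residue_classes_separated[OF g bnd nap] by (auto simp: X_def M_def)
  \<comment> \<open>A class constant from \<open>N\<close> on would converge along multiples of
    \<open>M\<close> and make \<open>x\<close> asymptotically periodic.\<close>
  have "\<exists>p q. N \<le> p \<and> N \<le> q \<and> p mod M = i \<and> q mod M = i \<and> X p \<noteq> X q" if "i < M" for i
  proof (rule ccontr)
    assume *: "\<not> ?thesis"
    have big: "N \<le> M * (n + N) + i" "(M * (n + N) + i) mod M = i" for n
    proof -
      have "N \<le> M * N" using that by simp
      then show "N \<le> M * (n + N) + i" unfolding add_mult_distrib2 by linarith
      show "(M * (n + N) + i) mod M = i" using that by simp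
    qed
    have const: "X (M * (n + N) + i) = X (M * (0 + N) + i)" for n
      using * big[of n] big[of 0] by blast
    have "convergent (\<lambda>n. X (M * (n + N) + i))" by (subst const) (rule convergent_const)
    then have "convergent (\<lambda>n. X (M * n + i))"
      using convergent_ignore_initial_segment[of "\<lambda>n. X (M * n + i)" N] by simp
    then have "asymptotically_periodic g ((g ^^ i) x)"
      unfolding asymptotically_periodic_def X_def using that
      by (intro exI[of _ M]) (simp add: funpow_add)
    then show False
      using nap asymptotically_periodic_shift[OF horseshoe_free_continuous[OF g]] by blast
  qed
  then obtain p q where pq: "\<And>i. i < M \<Longrightarrow> N \<le> p i \<and> N \<le> q i \<and> p i mod M = i \<and> q i mod M = i \<and> X (p i) \<noteq> X (q i)"
    by metis
  define d where "d = Min ((\<lambda>i. \<bar>X (p i) - X (q i)\<bar>) ` {..<M})"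
  have "M > 0" by (simp add: M_def)
  have "d > 0" unfolding d_def using pq \<open>M > 0\<close> by (subst Min_gr_iff) auto
  have d_le: "d \<le> \<bar>X (p i) - X (q i)\<bar>" if "i < M" for i
    unfolding d_def using that by (intro Min_le) auto
  \<comment> \<open>An error \<open>d / 8\<close> from the limit and another from closeness confine
    a class to width \<open>d / 2\<close>, below the spread \<open>d\<close> present in every
    class.\<close>
  obtain K where K: "\<And>n. n \<ge> K \<Longrightarrow> \<bar>(g ^^ (m * n)) y - l\<bar> < d / 8"
    using LIMSEQ_D[OF l, of "d / 8"] \<open>d > 0\<close> by auto
  obtain n where n: "n \<ge> max N (m * K)" "n mod m = 0"
    "\<And>j. j \<le> 2 * m \<Longrightarrow> \<bar>(g ^^ (n + j)) x - (g ^^ (n + j)) y\<bar> < d / 8"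
    using frequently_close_window[OF horseshoe_free_continuous[OF g] inv x y close, of "d / 8" 0 m "max N (m * K)" "2 * m"]
      \<open>d > 0\<close> m by auto
  obtain t where t: "n = m * t" using n(2) by auto
  have "K \<le> t" using n(1) m t by simp
  have near: "l - d / 4 \<le> X (n + m * c) \<and> X (n + m * c) \<le> l + d / 4" if "c \<le> 2" for c
  proof -
    have "m * c \<le> 2 * m" using that by simp
    then have "\<bar>X (n + m * c) - (g ^^ (n + m * c)) y\<bar> < d / 8" using n(3) by (simp add: X_def)
    moreover have "\<bar>(g ^^ (n + m * c)) y - l\<bar> < d / 8"
      using K[of "t + c"] \<open>K \<le> t\<close> by (simp add: t add_mult_distrib2)
    ultimately show ?thesis by linarith
  qed
  have mods: "(a + b) mod M \<noteq> a mod M" if "0 < b" "b < M" for a b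
    using that by (auto simp: mod_eq_dvd_iff_nat dest: dvd_imp_le)
  have "\<exists>b\<in>{n, n + m, n + 2 * m}. \<forall>p\<ge>N. p mod M = b mod M \<longrightarrow> l - d / 4 \<le> X p \<and> X p \<le> l + d / 4"
  proof (rule middle_class_confined[OF N])
    show "n mod M \<noteq> (n + m) mod M" "n mod M \<noteq> (n + 2 * m) mod M"
      using mods[of m n] mods[of "2 * m" n] m \<open>2 * m < M\<close> by auto
    show "(n + m) mod M \<noteq> (n + 2 * m) mod M"
      using mods[of m "n + m"] m \<open>2 * m < M\<close> by (simp add: mult_2 add.assoc)
    show "\<forall>a\<in>{n, n + m, n + 2 * m}. l - d / 4 \<le> X a \<and> X a \<le> l + d / 4"
      using near[of 0] near[of 1] near[of 2] by (simp add: mult.commute)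
  qed (use n(1) in auto)
  then obtain b where b: "\<And>p. p \<ge> N \<Longrightarrow> p mod M = b mod M \<Longrightarrow> l - d / 4 \<le> X p \<and> X p \<le> l + d / 4"
    by blast
  have "b mod M < M" using \<open>M > 0\<close> by simp
  from b[of "p (b mod M)"] b[of "q (b mod M)"] pq[OF this] d_le[OF this] \<open>d > 0\<close>
  show False by linarith
qed

lemma frequently_close_same_limit:
  fixes g :: "real \<Rightarrow> real"
  assumes cont: "continuous_on {0..1} g" and inv: "g ` {0..1} \<subseteq> {0..1}"
    and x: "x \<in> {0..1}" and y: "y \<in> {0..1}" and close: "frequently_close g x y" and "M > 0"
    and lx: "(\<lambda>n. (g ^^ (M * n)) x) \<longlonglongrightarrow> p" and ly: "(\<lambda>n. (g ^^ (M * n)) y) \<longlonglongrightarrow> q"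
  shows "p = q"
proof (rule ccontr)
  assume "p \<noteq> q"
  define e where "e = \<bar>p - q\<bar> / 3"
  have "e > 0" using \<open>p \<noteq> q\<close> by (simp add: e_def)
  obtain K1 where K1: "\<And>n. n \<ge> K1 \<Longrightarrow> \<bar>(g ^^ (M * n)) x - p\<bar> < e"
    using LIMSEQ_D[OF lx \<open>e > 0\<close>] by auto
  obtain K2 where K2: "\<And>n. n \<ge> K2 \<Longrightarrow> \<bar>(g ^^ (M * n)) y - q\<bar> < e"
    using LIMSEQ_D[OF ly \<open>e > 0\<close>] by auto
  obtain n where n: "n \<ge> M * max K1 K2" "n mod M = 0"
    "\<And>j. j \<le> 0 \<Longrightarrow> \<bar>(g ^^ (n + j)) x - (g ^^ (n + j)) y\<bar> < e"
    using frequently_close_window[OF cont inv x y close \<open>e > 0\<close> \<open>M > 0\<close>] by metis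
  obtain t where t: "n = M * t" using n(2) by auto
  have "max K1 K2 \<le> t" using n(1) \<open>M > 0\<close> t by simp
  then have "\<bar>p - q\<bar> < 3 * e"
    using K1[of t] K2[of t] n(3)[of 0] t by simp
  then show False by (simp add: e_def)
qed

lemma convergent_funpow_mult:
  assumes "convergent (\<lambda>n. (g ^^ (m * n)) x)" "k > 0"
  shows "convergent (\<lambda>n. (g ^^ (m * k * n)) x)"
proof -
  have "strict_mono (\<lambda>n. k * n)" using assms(2) by (simp add: strict_mono_def)
  from convergent_subseq_convergent[OF assms(1) this] show ?thesis
    by (simp add: o_def mult.assoc)
qed

text \<open>Along multiples of the common period \<open>a * b * c\<close> all three orbits converge,
  and proximality forces equal limits.\<close>

lemma frequently_close_trans_asymptotically_periodic:
  fixes g :: "real \<Rightarrow> real"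
  assumes cont: "continuous_on {0..1} g" and inv: "g ` {0..1} \<subseteq> {0..1}"
    and x: "x \<in> {0..1}" and y: "y \<in> {0..1}" and z: "z \<in> {0..1}"
    and xy: "frequently_close g x y" and yz: "frequently_close g y z"
    and ap: "asymptotically_periodic g x" "asymptotically_periodic g y" "asymptotically_periodic g z"
  shows "frequently_close g x z"
proof -
  obtain a b c where abc: "a > 0" "b > 0" "c > 0" "convergent (\<lambda>n. (g ^^ (a * n)) x)"
    "convergent (\<lambda>n. (g ^^ (b * n)) y)" "convergent (\<lambda>n. (g ^^ (c * n)) z)"
    using ap unfolding asymptotically_periodic_def by blast
  define M where "M = a * b * c"
  have "M > 0" using abc by (simp add: M_def)
  have "convergent (\<lambda>n. (g ^^ (M * n)) x)" "convergent (\<lambda>n. (g ^^ (M * n)) y)"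
    "convergent (\<lambda>n. (g ^^ (M * n)) z)"
    using convergent_funpow_mult[OF abc(4), of "b * c"] convergent_funpow_mult[OF abc(5), of "a * c"]
      convergent_funpow_mult[OF abc(6), of "a * b"] abc(1-3)
    by (simp_all add: M_def mult_ac)
  then obtain p q r where l: "(\<lambda>n. (g ^^ (M * n)) x) \<longlonglongrightarrow> p" "(\<lambda>n. (g ^^ (M * n)) y) \<longlonglongrightarrow> q"
    "(\<lambda>n. (g ^^ (M * n)) z) \<longlonglongrightarrow> r"
    unfolding convergent_def by blast
  have "p = r"
    using frequently_close_same_limit[OF cont inv x y xy \<open>M > 0\<close> l(1,2)]
      frequently_close_same_limit[OF cont inv y z yz \<open>M > 0\<close> l(2,3)] by simp
  then have lim: "(\<lambda>n. (g ^^ (M * n)) x - (g ^^ (M * n)) z) \<longlonglongrightarrow> 0"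
    using tendsto_diff[OF l(1,3)] by simp
  show ?thesis
    unfolding frequently_close_def
  proof (intro allI impI)
    fix e :: real and N
    assume "e > 0"
    then obtain K where K: "\<And>n. n \<ge> K \<Longrightarrow> \<bar>(g ^^ (M * n)) x - (g ^^ (M * n)) z\<bar> < e"
      using LIMSEQ_D[OF lim] by auto
    have "N \<le> M * max K N" using \<open>M > 0\<close> by (metis le_trans max.cobounded2 mult_le_mono1 nat_mult_1 Suc_leI One_nat_def)
    then show "\<exists>n\<ge>N. \<bar>(g ^^ n) x - (g ^^ n) z\<bar> < e" using K[of "max K N"] by auto
  qed
qed

lemma frequently_close_trans_not_asymptotically_periodic:
  fixes g :: "real \<Rightarrow> real"
  assumes g: "horseshoe_free g" and inv: "g ` {0..1} \<subseteq> {0..1}"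
    and x: "x \<in> {0..1}" and y: "y \<in> {0..1}" and z: "z \<in> {0..1}"
    and xy: "frequently_close g x y" and yz: "frequently_close g y z"
    and nap: "\<not> asymptotically_periodic g y" "\<not> asymptotically_periodic g z"
  shows "frequently_close g x z"
  unfolding frequently_close_def
proof (intro allI impI)
  fix e :: real and N0
  assume "e > 0"
  \<comment> \<open>Four legs: from \<open>x\<close> to \<open>y\<close> at time \<open>n\<close>,
    along \<open>y\<close> from \<open>n\<close> to \<open>n'\<close>, from \<open>y\<close> to
    \<open>z\<close> at \<open>n'\<close>, and along \<open>z\<close> back to
    \<open>n\<close>.\<close>
  define e' where "e' = e / 4"
  have "e' > 0" using \<open>e > 0\<close> by (simp add: e'_def)
  define B where "B = nat (\<lfloor>1 / e'\<rfloor> + 1)"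
  \<comment> \<open>At most \<open>B\<close> classes are wide for \<open>y\<close> and at most
    \<open>B\<close> for \<open>z\<close>. As \<open>M > 2 * B\<close>, some class \<open>i\<close>
    is narrow for both.\<close>
  define M :: nat where "M = 2 ^ (2 * B)"
  have "M > 2 * B" unfolding M_def by (rule less_exp)
  define Y where "Y = (\<lambda>n. (g ^^ n) y)"
  define Z where "Z = (\<lambda>n. (g ^^ n) z)"
  have range: "range Y \<subseteq> {0..1}" "range Z \<subseteq> {0..1}"
    using funpow_in[OF inv y] funpow_in[OF inv z] unfolding Y_def Z_def by blast+
  have bnd: "bounded (range (\<lambda>n. (g ^^ n) y))" "bounded (range (\<lambda>n. (g ^^ n) z))"
    using range bounded_subset[OF bounded_closed_interval[of 0 1]] unfolding Y_def Z_def by blast+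
  obtain N1 where N1: "separated Y M N1"
    using residue_classes_separated[OF g bnd(1) nap(1)] unfolding Y_def M_def by blast
  obtain N2 where N2: "separated Z M N2"
    using residue_classes_separated[OF g bnd(2) nap(2)] unfolding Z_def M_def by blast
  define W where "W X N = {i. i < M \<and> (\<exists>p\<ge>N. \<exists>q\<ge>N. p mod M = i \<and> q mod M = i \<and> X q - X p > e')}"
    for X :: "nat \<Rightarrow> real" and N
  have "card (W Y N1) \<le> B" "card (W Z N2) \<le> B"
    unfolding W_def B_def by (rule few_wide_classes[OF N1 range(1) \<open>e' > 0\<close>], rule few_wide_classes[OF N2 range(2) \<open>e' > 0\<close>])
  then have "card (W Y N1 \<union> W Z N2) < M"
    using card_Un_le[of "W Y N1" "W Z N2"] \<open>M > 2 * B\<close> by linarith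
  moreover have "card {..<M} \<le> card (W Y N1 \<union> W Z N2)" if "{..<M} \<subseteq> W Y N1 \<union> W Z N2"
    by (rule card_mono[OF _ that]) (simp add: W_def)
  ultimately obtain i where i: "i < M" "i \<notin> W Y N1" "i \<notin> W Z N2"
    by fastforce
  have narrow: "\<bar>Y a - Y b\<bar> \<le> e'" "\<bar>Z a - Z b\<bar> \<le> e'"
    if "a \<ge> max N1 N2" "b \<ge> max N1 N2" "a mod M = i" "b mod M = i" for a b
    using i that unfolding W_def abs_le_iff by (auto simp: not_less)
  define K where "K = max N0 (max N1 N2)"
  note window = frequently_close_window[OF horseshoe_free_continuous[OF g] inv _ _ _ \<open>e' > 0\<close> i(1)]
  obtain n where n: "n \<ge> K" "n mod M = i" "\<And>j. j \<le> 0 \<Longrightarrow> \<bar>(g ^^ (n + j)) x - (g ^^ (n + j)) y\<bar> < e'"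
    using window[OF x y xy] by metis
  obtain n' where n': "n' \<ge> K" "n' mod M = i" "\<And>j. j \<le> 0 \<Longrightarrow> \<bar>(g ^^ (n' + j)) y - (g ^^ (n' + j)) z\<bar> < e'"
    using window[OF y z yz] by metis
  have "\<bar>(g ^^ n) x - Y n\<bar> < e'" "\<bar>Y n' - Z n'\<bar> < e'"
    using n(3)[of 0] n'(3)[of 0] by (auto simp: Y_def Z_def)
  moreover have "\<bar>Y n - Y n'\<bar> \<le> e'" "\<bar>Z n' - Z n\<bar> \<le> e'"
    using narrow[of n n'] narrow[of n' n] n n' by (auto simp: K_def)
  ultimately have "\<bar>(g ^^ n) x - Z n\<bar> < e" unfolding e'_def by linarith
  then show "\<exists>n\<ge>N0. \<bar>(g ^^ n) x - (g ^^ n) z\<bar> < e"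
    using n(1) by (auto simp: K_def Z_def)
qed

text \<open>Asymptotic periodicity passes along proximal pairs, so the behaviour of \<open>y\<close>
  decides which of the two preceding cases applies.\<close>

lemma frequently_close_trans:
  fixes g :: "real \<Rightarrow> real"
  assumes g: "horseshoe_free g" and inv: "g ` {0..1} \<subseteq> {0..1}"
    and x: "x \<in> {0..1}" and y: "y \<in> {0..1}" and z: "z \<in> {0..1}"
    and xy: "frequently_close g x y" and yz: "frequently_close g y z"
  shows "frequently_close g x z"
proof (cases "asymptotically_periodic g y")
  case True
  then have "asymptotically_periodic g x" "asymptotically_periodic g z"
    using frequently_close_asymptotically_periodic[OF g inv x y xy]
      frequently_close_asymptotically_periodic[OF g inv z y] yz frequently_close_sym by blast+
  then show ?thesis
    using frequently_close_trans_asymptotically_periodic[OF horseshoe_free_continuous[OF g] inv x y z xy yz] True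
    by blast
next
  case False
  then have "\<not> asymptotically_periodic g z"
    using frequently_close_asymptotically_periodic[OF g inv y z yz] by blast
  then show ?thesis
    using frequently_close_trans_not_asymptotically_periodic[OF g inv x y z xy yz False] by blast
qed

section \<open>Positive entropy from a horseshoe\<close>

text \<open>Itineraries are words over \<open>bool\<close>, with \<open>True\<close> standing for
  \<open>J\<close>. The point for a longer word is a preimage of the point for its tail, chosen in
  the set named by the first letter.\<close>

lemma horseshoe_itinerary:
  assumes "J \<noteq> {}" "J \<union> K \<subseteq> G ` J" "J \<union> K \<subseteq> G ` K"
  shows "\<exists>x\<in>J \<union> K. \<forall>i<length s. (G ^^ i) x \<in> (if s ! i then J else K)"
proof (induction s)
  case Nil
  then show ?case using assms(1) by auto
next
  case (Cons b s)
  then obtain x' where x': "x' \<in> J \<union> K" "\<forall>i<length s. (G ^^ i) x' \<in> (if s ! i then J else K)"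
    by blast
  then obtain x where x: "x \<in> (if b then J else K)" "G x = x'"
    using assms(2,3) by (cases b) auto
  have "(G ^^ i) x \<in> (if (b # s) ! i then J else K)" if "i < length (b # s)" for i
  proof (cases i)
    case 0
    then show ?thesis using x by simp
  next
    case (Suc k)
    then show ?thesis using x' x that by (simp add: funpow_swap1)
  qed
  moreover have "x \<in> J \<union> K" using x by (auto split: if_splits)
  ultimately show ?case by blast
qed

text \<open>\<open>Sup\<close> on \<open>nat\<close> dominates the members only of a bounded set, so
  the cardinalities must be bounded first. Recording the cell of width \<open>e\<close> visited at
  each time is injective on a separated set and has finitely many possible values.\<close>

lemma card_separated_le_sep_num:
  assumes inv: "f ` {0..1} \<subseteq> {0..1}" and "e > 0" and S: "finite S" "sep_set f n e S"
  shows "card S \<le> sep_num f n e"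
proof -
  let ?C = "{l. set l \<subseteq> {0..\<lfloor>1 / e\<rfloor>} \<and> length l = n}"
  have fin: "finite ?C" by (rule finite_lists_length_eq) simp
  have bound: "card S \<le> card ?C" if S: "sep_set f n e S" for S
  proof (rule card_inj_on_le[OF _ _ fin])
    define code where "code x = map (\<lambda>k. \<lfloor>(f ^^ k) x / e\<rfloor>) [0..<n]" for x
    show "inj_on code S"
    proof (rule inj_onI, rule ccontr)
      fix x y
      assume xy: "x \<in> S" "y \<in> S" "code x = code y" "x \<noteq> y"
      then obtain k where k: "k < n" "\<bar>(f ^^ k) x - (f ^^ k) y\<bar> > e"
        using S unfolding sep_set_def by blast
      then have "\<lfloor>(f ^^ k) x / e\<rfloor> = \<lfloor>(f ^^ k) y / e\<rfloor>"
        using xy(3) by (simp add: code_def)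
      then have "\<bar>(f ^^ k) x / e - (f ^^ k) y / e\<bar> < 1" by linarith
      then have "\<bar>(f ^^ k) x - (f ^^ k) y\<bar> / e < 1"
        using \<open>e > 0\<close> by (simp add: diff_divide_distrib[symmetric])
      then show False using k \<open>e > 0\<close> by simp
    qed
    show "code ` S \<subseteq> ?C"
    proof (intro image_subsetI)
      fix x assume "x \<in> S"
      then have "x \<in> {0..1}" using S by (auto simp: sep_set_def)
      then have "(f ^^ k) x \<in> {0..1}" for k by (rule funpow_in[OF inv])
      then have "\<lfloor>(f ^^ k) x / e\<rfloor> \<in> {0..\<lfloor>1 / e\<rfloor>}" for k
        using \<open>e > 0\<close> by (auto intro!: floor_mono divide_right_mono)
      then show "code x \<in> ?C" by (auto simp: code_def)
    qed
  qed
  have "bdd_above {card S | S. finite S \<and> sep_set f n e S}"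
    using bound by (intro bdd_aboveI[of _ "card ?C"]) blast
  then show ?thesis
    unfolding sep_num_def using S by (intro cSup_upper) auto
qed

text \<open>The \<open>2 ^ n\<close> words of length \<open>n\<close> give points separated within
  \<open>m * n\<close> steps of \<open>f\<close>, so the growth rate is at least
  \<open>ln 2 / m\<close>.\<close>

lemma horseshoe_imp_top_entropy_pos:
  assumes inv: "f ` {0..1} \<subseteq> {0..1}" and agree: "\<And>x. x \<in> {0..1} \<Longrightarrow> F x = f x"
    and range: "range F \<subseteq> {0..1}" and "m > 0" and hs: "horseshoe (F ^^ m)"
  shows "top_entropy f > 0"
proof -
  define G where "G = F ^^ m"
  obtain J K \<eta> where h: "\<eta> > 0" "J \<noteq> {}" "J \<union> K \<subseteq> G ` J" "J \<union> K \<subseteq> G ` K"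
    "\<And>u v. u \<in> J \<Longrightarrow> v \<in> K \<Longrightarrow> \<eta> \<le> \<bar>u - v\<bar>"
    using hs unfolding horseshoe_def G_def by blast
  \<comment> \<open>As \<open>m > 0\<close>, the outermost application of \<open>F\<close> lands in
    the unit interval, and \<open>J\<close> and \<open>K\<close> are covered by that image.\<close>
  have "G ` J \<subseteq> {0..1}"
    using range \<open>m > 0\<close> unfolding G_def by (cases m) (auto simp: image_subset_iff)
  then have JK: "J \<union> K \<subseteq> {0..1}" using h(3) by (rule order_trans[rotated])
  have eq: "(F ^^ k) x = (f ^^ k) x" if "x \<in> {0..1}" for k x
    by (induction k) (use agree funpow_in[OF inv that] in auto)
  have "\<forall>s. \<exists>x\<in>J \<union> K. \<forall>i<length s. (G ^^ i) x \<in> (if s ! i then J else K)"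
    using horseshoe_itinerary[OF h(2-4)] by blast
  then obtain pt where pt: "\<And>s. pt s \<in> J \<union> K"
    "\<And>s i. i < length s \<Longrightarrow> (G ^^ i) (pt s) \<in> (if s ! i then J else K)"
    by metis
  have pt01: "pt s \<in> {0..1}" for s using pt(1) JK by blast
  \<comment> \<open>Half the gap, since \<open>sep_set\<close> demands a strict inequality.\<close>
  define e where "e = \<eta> / 2"
  have "e > 0" using h by (simp add: e_def)
  have apart: "\<exists>k<m * n. \<bar>(f ^^ k) (pt s) - (f ^^ k) (pt t)\<bar> > e"
    if st: "length s = n" "length t = n" "s \<noteq> t" for s t n
  proof -
    obtain i where i: "i < n" "s ! i \<noteq> t ! i" using st nth_equalityI[of s t] by auto
    have "\<eta> \<le> \<bar>(G ^^ i) (pt s) - (G ^^ i) (pt t)\<bar>"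
      using pt(2)[of i s] pt(2)[of i t] i st h(5)[of "(G ^^ i) (pt s)" "(G ^^ i) (pt t)"]
        h(5)[of "(G ^^ i) (pt t)" "(G ^^ i) (pt s)"] by (cases "s ! i") (auto simp: abs_minus_commute)
    then have "\<bar>(f ^^ (m * i)) (pt s) - (f ^^ (m * i)) (pt t)\<bar> > e"
      using h(1) eq[OF pt01] by (simp add: G_def funpow_mult e_def)
    moreover have "m * i < m * n" using i \<open>m > 0\<close> by simp
    ultimately show ?thesis by blast
  qed
  have sep: "2 ^ n \<le> sep_num f (m * n) e" for n
  proof -
    let ?L = "{s :: bool list. set s \<subseteq> UNIV \<and> length s = n}"
    have fin: "finite ?L" by (rule finite_lists_length_eq) simp
    have "inj_on pt ?L"
    proof (rule inj_onI, rule ccontr)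
      fix s t assume st: "s \<in> ?L" "t \<in> ?L" "pt s = pt t" "s \<noteq> t"
      then show False using apart[of s n t] \<open>e > 0\<close> by auto
    qed
    then have "card (pt ` ?L) = card ?L" by (rule card_image)
    also have "\<dots> = 2 ^ n" by (subst card_lists_length_eq) auto
    finally have card: "card (pt ` ?L) = 2 ^ n" .
    have "sep_set f (m * n) e (pt ` ?L)"
      unfolding sep_set_def using pt01 apart by (auto simp: image_subset_iff) blast
    from card_separated_le_sep_num[OF inv \<open>e > 0\<close> _ this] show ?thesis
      using fin card by simp
  qed
  let ?h = "\<lambda>n. ereal (ln (real (sep_num f n e)) / real n)"
  \<comment> \<open>The lower bound is known only at multiples of \<open>m\<close>. This suffices
    for a limsup: a smaller one would force a strict upper bound at all late times.\<close>
  have "ereal (ln 2 / real m) \<le> limsup ?h"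
  proof (rule ccontr)
    assume "\<not> ?thesis"
    then have "limsup ?h < ereal (ln 2 / real m)" by simp
    then have "\<forall>\<^sub>F n in sequentially. ?h n < ereal (ln 2 / real m)" by (rule Limsup_lessD)
    then obtain N where N: "\<And>n. n \<ge> N \<Longrightarrow> ln (real (sep_num f n e)) / real n < ln 2 / real m"
      unfolding eventually_sequentially by auto
    have "N \<le> m * Suc N" using \<open>m > 0\<close> by (cases m) auto
    then obtain n where n: "n > 0" "N \<le> m * n" by blast
    have "ln (real (sep_num f (m * n) e)) / real (m * n) < ln 2 / real m"
      by (rule N[OF n(2)])
    then have lt: "ln (real (sep_num f (m * n) e)) < real n * ln 2"
      using \<open>m > 0\<close> n(1) by (simp add: field_simps)
    have "real n * ln 2 = ln (2 ^ n)" by (simp add: ln_realpow)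
    also have "\<dots> \<le> ln (real (sep_num f (m * n) e))"
      using sep[of n] by (subst ln_le_cancel_iff) (auto simp flip: of_nat_le_iff intro: less_le_trans[of _ "2 ^ n"])
    finally show False using lt by simp
  qed
  also have "limsup ?h \<le> top_entropy f"
    unfolding top_entropy_def using \<open>e > 0\<close> by (intro SUP_upper) auto
  finally have "ereal (ln 2 / real m) \<le> top_entropy f" .
  moreover have "0 < ereal (ln 2 / real m)" using \<open>m > 0\<close> by simp
  ultimately show ?thesis by (rule less_le_trans[rotated])
qed

section \<open>Continuous extension to the line and conclusion\<close>

theorem mainTheorem4:
  fixes f :: "real \<Rightarrow> real"
  assumes "continuous_on {0..1} f" and "f ` {0..1} \<subseteq> {0..1}"
    and "top_entropy f = 0"
  shows "equiv {0..1} (Prox f)"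
proof -
  \<comment> \<open>Outside the unit interval \<open>f\<close> is arbitrary, so it is replaced by a continuous extension.\<close>
  define F where "F t = f (max 0 (min 1 t))" for t
  have agree: "F x = f x" if "x \<in> {0..1}" for x using that by (simp add: F_def)
  have range: "range F \<subseteq> {0..1}" using assms(2) by (auto simp: F_def image_subset_iff)
  then have inv: "F ` {0..1} \<subseteq> {0..1}" by blast
  have "continuous_on UNIV F"
    unfolding F_def
    by (rule continuous_on_compose2[OF assms(1)]) (auto intro!: continuous_intros)
  moreover have "\<not> horseshoe (F ^^ m)" if "m > 0" for m
    using horseshoe_imp_top_entropy_pos[OF assms(2) agree range that] assms(3) by auto
  ultimately have free: "horseshoe_free F" by (simp add: horseshoe_free_def)
  have iter: "(F ^^ n) x = (f ^^ n) x" if "x \<in> {0..1}" for n x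
    by (induction n) (use agree funpow_in[OF assms(2) that] in auto)
  \<comment> \<open>Iterates of \<open>f\<close> and \<open>F\<close> agree on the unit interval, so
    the results for \<open>F\<close> transfer to \<open>Prox f\<close>.\<close>
  have Prox: "(x, y) \<in> Prox f \<longleftrightarrow> x \<in> {0..1} \<and> y \<in> {0..1} \<and> frequently_close F x y" for x y
    unfolding Prox_def proximal_iff_frequently_close using iter by (auto simp: frequently_close_def)
  show ?thesis
  proof (rule equivI)
    show "Prox f \<subseteq> {0..1} \<times> {0..1}" by (auto simp: Prox_def)
    show "refl_on {0..1} (Prox f)"
      unfolding refl_on_def Prox by (auto simp: Prox frequently_close_def)
    show "sym (Prox f)"
      unfolding sym_def Prox using frequently_close_sym by blast
    show "trans (Prox f)"
      unfolding trans_def Prox using frequently_close_trans[OF free inv] by blast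
  qed
qed

end
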